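(* Let $n \in \mathbb{N}$ and let $\mathscr{C}$ be a collection of $n$ unit vectors in $\mathbb{C}^r$ with corresponding Gram matrix $M = M_{\mathscr{C}}$. Then \[ \mathbf{1}^{\intercal} \left(M \odot \overline{M}\right)^{\dagger} \mathbf{1} \leq r, \] with equality if and only if the $r \times r$ identity matrix is in the span of $\{ v v^* : v \in \mathscr{C} \}$. Moreover, \[ \sum_{u,v \in \mathscr{C}}|\langle u, v\rangle|^2 \geq \frac{n^2}{\mathbf{1}^{\intercal} \left(M \odot \overline{M}\right)^{\dagger} \mathbf{1}}, \] and when $M \odot \overline{M}$ is invertible, we have equality in this last inequality if and only if $\mathbf{1}$ is an eigenvector of $M \odot \overline{M}$.
   Context: $\langle u,v\rangle = u^*v$ is the standard inner product on $\mathbb{C}^r$. The Gram matrix $M_{\mathscr{C}}\in\mathbb{C}^{\mathscr{C}\times\mathscr{C}}$ has entries $M_{\mathscr{C}}(u,v)=\langle u,v\rangle$. $\odot$ is the Hadamard (entrywise) product, so $M\odot\overline{M}$ has entries $|\langle u,v\rangle|^2$. $\mathbf{1}$ is the all ones vector in $\mathbb{C}^{\mathscr{C}}$. For a Hermitian matrix $H = \sum_i \lambda_i u_i u_i^*$ with orthonormal eigenvectors $u_i$, the Moore–Penrose inverse is $H^{\dagger} = \sum_{i:\lambda_i\neq 0}\frac{1}{\lambda_i}u_iu_i^*$. *)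

theory Defs
  imports "Jordan_Normal_Form.Char_Poly" "Jordan_Normal_Form.VS_Connect"
begin

text \<open>
  The order on \<^typ>\<open>complex\<close> is the one of \<open>HOL-Library.Complex_Order\<close>:
  \<open>x \<le> y\<close> means \<open>Re x \<le> Re y\<close> and \<open>Im x = Im y\<close>. Hence an
  inequality with a real number includes the claim that the other side is real.
\<close>

text \<open>\<open>u\<^sup>* v\<close>, conjugate-linear in the first argument, as opposed to \<open>\<bullet>c\<close>.\<close>

definition herm_inner :: "complex vec \<Rightarrow> complex vec \<Rightarrow> complex" where
  "herm_inner u v = conjugate u \<bullet> v"

text \<open>\<open>v v\<^sup>*\<close>\<close>

definition outer_sq :: "complex vec \<Rightarrow> complex mat" where
  "outer_sq v = mat (dim_vec v) (dim_vec v) (\<lambda>(i, j). v $ i * cnj (v $ j))"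

definition ones_vec :: "nat \<Rightarrow> complex vec" where
  "ones_vec n = vec n (\<lambda>_. 1)"

definition hadamard :: "complex mat \<Rightarrow> complex mat \<Rightarrow> complex mat" where
  "hadamard A B = mat (dim_row A) (dim_col A) (\<lambda>(i, j). A $$ (i, j) * B $$ (i, j))"

text \<open>
  A collection of \<open>n\<close> vectors is a family indexed by \<open>{..<n}\<close>, so its Gram matrix
  has rows and columns indexed by \<open>{..<n}\<close>.
\<close>

definition gram_mat :: "nat \<Rightarrow> (nat \<Rightarrow> complex vec) \<Rightarrow> complex mat" where
  "gram_mat n v = mat n n (\<lambda>(i, j). herm_inner (v i) (v j))"

text \<open>
  Sum of a family of \<open>n \<times> n\<close> matrices. The type \<^typ>\<open>complex mat\<close> contains
  matrices of all sizes and is not an additive monoid, so \<^const>\<open>sum\<close> does not apply to it.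
\<close>

definition sum_mats :: "nat \<Rightarrow> ('i \<Rightarrow> complex mat) \<Rightarrow> 'i set \<Rightarrow> complex mat" where
  "sum_mats n F I = mat n n (\<lambda>(a, b). \<Sum>i\<in>I. F i $$ (a, b))"

text \<open>
  \<open>H = \<Sum>\<^sub>i \<lambda>\<^sub>i u\<^sub>i u\<^sub>i\<^sup>*\<close> with orthonormal \<open>u\<^sub>i\<close>; these
  are then eigenvectors of \<open>H\<close> for the real eigenvalues \<open>\<lambda>\<^sub>i\<close>.
\<close>

definition spectral_decomp ::
    "complex mat \<Rightarrow> (nat \<Rightarrow> real) \<Rightarrow> (nat \<Rightarrow> complex vec) \<Rightarrow> bool" where
  "spectral_decomp H l u \<longleftrightarrow>
     (let n = dim_row H in
       (\<forall>i<n. u i \<in> carrier_vec n) \<and>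
       (\<forall>i<n. \<forall>j<n. herm_inner (u i) (u j) = (if i = j then 1 else 0)) \<and>
       H = sum_mats n (\<lambda>i. complex_of_real (l i) \<cdot>\<^sub>m outer_sq (u i)) {..<n})"

text \<open>
  The Moore--Penrose inverse of a Hermitian matrix. The value does not depend on the chosen
  spectral decomposition. For a matrix that is not Hermitian there is no such
  decomposition, and the value is unspecified.
\<close>

definition pinv :: "complex mat \<Rightarrow> complex mat" where
  "pinv H = (THE P. \<exists>l u. spectral_decomp H l u \<and>
     P = sum_mats (dim_row H) (\<lambda>i. complex_of_real (1 / l i) \<cdot>\<^sub>m outer_sq (u i))
           {i. i < dim_row H \<and> l i \<noteq> 0})"

text \<open>The complex linear span of a set of \<open>r \<times> r\<close> matrices.\<close>

abbreviation mat_span :: "nat \<Rightarrow> complex mat set \<Rightarrow> complex mat set" where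
  "mat_span r \<equiv> LinearCombinations.module.span class_ring (module_mat TYPE(complex) r r)"

end

theory Submission
  imports Defs "Jordan_Normal_Form.Spectral_Radius"
begin

text \<open>
  The matrix \<open>A = M \<odot> cnj M\<close> is the Gram matrix of the rank one matrices \<open>v\<^sub>i v\<^sub>i\<^sup>*\<close> for the
  Frobenius inner product, and \<open>\<langle>I, v\<^sub>i v\<^sub>i\<^sup>*\<rangle> = 1\<close>. Put \<open>w = A\<^sup>\<dagger> 1\<close>, so that \<open>A w = 1\<close>, and
  \<open>Y = \<Sum> w\<^sub>i v\<^sub>i v\<^sub>i\<^sup>*\<close>, \<open>Z = \<Sum> v\<^sub>i v\<^sub>i\<^sup>*\<close>. Then \<open>q = \<Sum> w\<^sub>i = \<langle>I, Y\<rangle> = \<parallel>Y\<parallel>\<^sup>2\<close>, hence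
  \<open>r - q = \<parallel>I - Y\<parallel>\<^sup>2\<close>, and \<open>Y\<close> is the projection of \<open>I\<close> to the span of the \<open>v\<^sub>i v\<^sub>i\<^sup>*\<close>. Similarly
  \<open>\<parallel>Z\<parallel>\<^sup>2 = S\<close> and \<open>\<langle>Z, Y\<rangle> = n\<close>, hence \<open>S - n\<^sup>2 / q = \<parallel>Z - (n / q) Y\<parallel>\<^sup>2\<close>.
\<close>

subsection \<open>Diagonalization of Hermitian matrices\<close>

lemma mat_adjoint_dim [simp]:
  "dim_row (mat_adjoint A) = dim_col A" "dim_col (mat_adjoint A) = dim_row A"
  by (simp_all add: mat_adjoint_def)

lemma mat_adjoint_carrier [simp]: "A \<in> carrier_mat m n \<Longrightarrow> mat_adjoint A \<in> carrier_mat n m"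
  by (intro carrier_matI) simp_all

lemma index_mat_adjoint [simp]:
  "i < dim_col A \<Longrightarrow> j < dim_row A \<Longrightarrow> mat_adjoint A $$ (i, j) = conjugate (A $$ (j, i))"
  by (simp add: mat_adjoint_def mat_of_rows_def)

lemma mat_adjoint_mult:
  fixes A B :: "complex mat"
  assumes "A \<in> carrier_mat m n" "B \<in> carrier_mat n k"
  shows "mat_adjoint (A * B) = mat_adjoint B * mat_adjoint A"
proof (rule eq_matI)
  fix i j assume "i < dim_row (mat_adjoint B * mat_adjoint A)" "j < dim_col (mat_adjoint B * mat_adjoint A)"
  then have "i < k" "j < m" using assms by auto
  then show "mat_adjoint (A * B) $$ (i, j) = (mat_adjoint B * mat_adjoint A) $$ (i, j)"
    using assms by (simp add: scalar_prod_def mult.commute[of "cnj (A $$ _)"])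
qed (use assms in auto)

lemma mat_adjoint_adjoint [simp]: "mat_adjoint (mat_adjoint A) = (A :: complex mat)"
  by (rule eq_matI) simp_all

text \<open>The middle factor \<open>V * U\<close> cancels, so sending \<open>X\<close> to
  \<open>U * X * V\<close> respects products. This reduces identities between a Hermitian matrix and
  its pseudo-inverse to diagonal matrices.\<close>

lemma conj_mult_conj:
  fixes U X Y :: "'a :: comm_ring_1 mat"
  assumes "U \<in> carrier_mat m n" "V \<in> carrier_mat n m" "X \<in> carrier_mat n n" "Y \<in> carrier_mat n n"
    and "V * U = 1\<^sub>m n"
  shows "(U * X * V) * (U * Y * V) = U * (X * Y) * V"
proof -
  have "(U * X * V) * (U * Y * V) = U * (X * ((V * U) * (Y * V)))"
    using assms(1-4) by (simp add: assoc_mult_mat[of _ m n _ n _ m] assoc_mult_mat[of _ n n _ m _ m]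
      assoc_mult_mat[of _ m n _ m _ m] assoc_mult_mat[of _ n m _ n _ m] mult_carrier_mat[of _ n n _ m]
      mult_carrier_mat[of _ m n _ m])
  also have "\<dots> = U * (X * Y) * V"
    using assms by (simp add: assoc_mult_mat[of _ m n _ n _ m] assoc_mult_mat[of _ n n _ n _ m] mult_carrier_mat[of _ n n _ m])
  finally show ?thesis .
qed

text \<open>Complete \<open>w\<close> to a basis, apply Gram-Schmidt and normalize. Gram-Schmidt
  keeps the first vector, so the first column is a multiple of \<open>w\<close>.\<close>

lemma unitary_with_first_col:
  fixes w :: "complex vec"
  assumes w: "w \<in> carrier_vec n" and w0: "w \<noteq> 0\<^sub>v n"
  obtains W c where "W \<in> carrier_mat n n" "mat_adjoint W * W = 1\<^sub>m n" "col W 0 = c \<cdot>\<^sub>v w"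
proof -
  interpret cof_vec_space n "TYPE(complex)" .
  define ws where "ws = gram_schmidt n (basis_completion w)"
  \<comment> \<open>The vectors \<open>ws\<close> are orthogonal but not normalized;
    \<open>c i\<close> is the reciprocal of the norm of \<open>ws ! i\<close>.\<close>
  define c where "c i = complex_of_real (1 / sqrt (Re (ws ! i \<bullet>c ws ! i)))" for i
  define W where "W = mat n n (\<lambda>(a, i). c i * ws ! i $ a)"
  note b = basis_completion[OF w w0]
  have n: "n > 0" using w w0 by (cases n) auto
  have ws: "corthogonal ws" "set ws \<subseteq> carrier_vec n" "length ws = n"
    using gram_schmidt_result[OF b(2) b(4) b(5) ws_def] b(6) by auto
  have hd: "ws ! 0 = w"
  proof -
    have "basis_completion w = w # tl (basis_completion w)"
      using b(6,7) n by (cases "basis_completion w") auto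
    then have "hd ws = w" unfolding ws_def using gram_schmidt_hd[OF w] by metis
    then show ?thesis using ws(3) n by (simp add: hd_conv_nth flip: length_greater_0_conv)
  qed
  have car: "ws ! i \<in> carrier_vec n" if "i < n" for i using ws that by auto
  \<comment> \<open>Being \<open>corthogonal\<close> includes that no vector of \<open>ws\<close> is
    zero.\<close>
  have nz: "ws ! i \<bullet>c ws ! i > 0" if "i < n" for i
    using corthogonalD[OF ws(1), of i i] that ws(3) conjugate_square_ge_0_vec[of "ws ! i"]
    by (simp add: order_less_le)
  have "mat_adjoint W * W = 1\<^sub>m n"
  proof (rule eq_matI, unfold index_one_mat)
    fix i j assume i: "i < n" and j: "j < n"
    have "(mat_adjoint W * W) $$ (i, j) = (\<Sum>a<n. cnj (c i * ws ! i $ a) * (c j * ws ! j $ a))"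
      using i j by (simp add: scalar_prod_def W_def atLeast0LessThan)
    also have "\<dots> = c i * c j * (ws ! j \<bullet>c ws ! i)"
    proof -
      have "cnj (c i) = c i" by (simp add: c_def)
      then show ?thesis using car[OF i] car[OF j]
        by (simp add: scalar_prod_def sum_distrib_left mult_ac atLeast0LessThan)
    qed
    also have "\<dots> = (if i = j then 1 else 0)"
    proof (cases "i = j")
      case True
      define z where "z = ws ! i \<bullet>c ws ! i"
      have z: "0 < Re z" "Im z = 0" using nz[OF i] by (auto simp: z_def less_complex_def)
      have ci: "c i = complex_of_real (1 / sqrt (Re z))" by (simp add: c_def z_def)
      have "z = complex_of_real (Re z)" using z by (simp add: complex_eq_iff)
      then have "c i * c i * z = complex_of_real (1 / sqrt (Re z) * (1 / sqrt (Re z)) * Re z)"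
        unfolding ci of_real_mult by simp
      also have "1 / sqrt (Re z) * (1 / sqrt (Re z)) * Re z = 1" using z by simp
      finally have "c i * c i * z = 1" by simp
      then show ?thesis using True by (simp add: z_def)
    next
      case False
      then show ?thesis using corthogonalD[OF ws(1), of j i] i j ws(3) by simp
    qed
    finally show "(mat_adjoint W * W) $$ (i, j) = (if i = j then 1 else 0)" .
  qed (auto simp: W_def)
  moreover have "col W 0 = c 0 \<cdot>\<^sub>v w" using n w by (intro eq_vecI) (auto simp: W_def hd)
  moreover have "W \<in> carrier_mat n n" by (simp add: W_def)
  ultimately show ?thesis using that by blast
qed

text \<open>Induction on the dimension: in an orthonormal basis that starts with an eigenvector, a
  Hermitian matrix splits into the eigenvalue and a smaller Hermitian block.\<close>

theorem hermitian_diagonalization: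
  fixes A :: "complex mat"
  assumes "A \<in> carrier_mat n n" "mat_adjoint A = A"
  shows "\<exists>U D. U \<in> carrier_mat n n \<and> D \<in> carrier_mat n n \<and> diagonal_mat D \<and>
    mat_adjoint U * U = 1\<^sub>m n \<and> A = U * D * mat_adjoint U"
  using assms
proof (induction n arbitrary: A)
  case 0
  then show ?case by (intro exI[of _ A]) (auto simp: diagonal_mat_def intro!: eq_matI)
next
  case (Suc n)
  note A = Suc.prems
  obtain e w where ev: "eigenvector A w e"
    using spectrum_non_empty[OF A(1)] by (auto simp: spectrum_def eigenvalue_def)
  then have w: "w \<in> carrier_vec (Suc n)" "w \<noteq> 0\<^sub>v (Suc n)" "A *\<^sub>v w = e \<cdot>\<^sub>v w"
    using A by (auto simp: eigenvector_def)
  obtain W c where W: "W \<in> carrier_mat (Suc n) (Suc n)" "mat_adjoint W * W = 1\<^sub>m (Suc n)"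
    and c: "col W 0 = c \<cdot>\<^sub>v w"
    using unitary_with_first_col[OF w(1,2)] by metis
  define Wa where "Wa = mat_adjoint W"
  have Wa: "Wa \<in> carrier_mat (Suc n) (Suc n)" using W by (simp add: Wa_def)
  have WaW: "Wa * W = 1\<^sub>m (Suc n)" using W by (simp add: Wa_def)
  have WWa: "W * Wa = 1\<^sub>m (Suc n)" using mat_mult_left_right_inverse[OF Wa W(1) WaW] .
  \<comment> \<open>\<open>B\<close> is \<open>A\<close> written in the basis of the columns of
    \<open>W\<close>.\<close>
  define B where "B = Wa * A * W"
  have B: "B \<in> carrier_mat (Suc n) (Suc n)" using W Wa A by (simp add: B_def)
  have adjB: "mat_adjoint B = B"
  proof -
    have "mat_adjoint B = Wa * mat_adjoint (Wa * A)"
      unfolding B_def Wa_def by (rule mat_adjoint_mult) (use W(1) Wa A(1) in \<open>auto simp: Wa_def\<close>)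
    also have "mat_adjoint (Wa * A) = A * W"
      using mat_adjoint_mult[OF Wa A(1)] A(2) by (simp add: Wa_def)
    also have "Wa * (A * W) = B"
      unfolding B_def by (rule assoc_mult_mat[symmetric, OF Wa A(1) W(1)])
    finally show ?thesis .
  qed
  have AB: "A = W * B * Wa"
  proof -
    have "W * B * Wa = (W * Wa) * A * (W * Wa)"
      unfolding B_def using W(1) Wa A(1)
      by (simp add: assoc_mult_mat[of _ "Suc n" "Suc n" _ "Suc n" _ "Suc n"] mult_carrier_mat[of _ "Suc n" "Suc n"])
    then show ?thesis using A(1) by (simp add: WWa)
  qed
  \<comment> \<open>The first column of \<open>W\<close> is an eigenvector of \<open>A\<close>, so
    \<open>B\<close> maps the first basis vector to \<open>e\<close> times itself.\<close>
  have col0: "B $$ (i, 0) = (if i = 0 then e else 0)" if i: "i < Suc n" for i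
  proof -
    have "col B 0 = col (Wa * (A * W)) 0"
      unfolding B_def using assoc_mult_mat[OF Wa A(1) W(1)] by simp
    also have "\<dots> = Wa *\<^sub>v col (A * W) 0"
      by (rule col_mult2[OF Wa mult_carrier_mat[OF A(1) W(1)] zero_less_Suc])
    also have "col (A * W) 0 = A *\<^sub>v col W 0"
      by (rule col_mult2[OF A(1) W(1) zero_less_Suc])
    also have "A *\<^sub>v col W 0 = e \<cdot>\<^sub>v col W 0"
      unfolding c using w A(1) by (simp add: mult_mat_vec smult_smult_assoc mult.commute)
    also have "Wa *\<^sub>v (e \<cdot>\<^sub>v col W 0) = e \<cdot>\<^sub>v (Wa *\<^sub>v col W 0)"
      using Wa col_dim[of W 0] W(1) by (intro mult_mat_vec) (auto simp del: col_dim)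
    also have "Wa *\<^sub>v col W 0 = col (Wa * W) 0"
      by (rule col_mult2[OF Wa W(1) zero_less_Suc, symmetric])
    finally have "col B 0 $ i = (e \<cdot>\<^sub>v col (1\<^sub>m (Suc n)) 0) $ i" by (simp add: WaW)
    then show ?thesis using B i by simp
  qed
  \<comment> \<open>Hermitian symmetry carries the zeros of the first column over to the first
    row.\<close>
  have row0: "B $$ (0, i) = 0" if i: "0 < i" "i < Suc n" for i
  proof -
    have "B $$ (0, i) = cnj (B $$ (i, 0))"
      using B i by (subst adjB[symmetric]) simp
    then show ?thesis using col0 i by simp
  qed
  define B' where "B' = mat n n (\<lambda>(i, j). B $$ (Suc i, Suc j))"
  define E where "E = mat 1 1 (\<lambda>_. e)"
  have B': "B' \<in> carrier_mat n n" and E: "E \<in> carrier_mat 1 1" by (auto simp: B'_def E_def)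
  have "mat_adjoint B' = B'"
  proof (rule eq_matI)
    fix i j assume "i < dim_row B'" "j < dim_col B'"
    then have ij: "i < n" "j < n" using B' by auto
    have "mat_adjoint B $$ (Suc i, Suc j) = B $$ (Suc i, Suc j)" by (simp only: adjB)
    then show "mat_adjoint B' $$ (i, j) = B' $$ (i, j)" using ij B by (simp add: B'_def)
  qed (use B' in auto)
  from Suc.IH[OF B' this] obtain U D where U: "U \<in> carrier_mat n n" "mat_adjoint U * U = 1\<^sub>m n"
    and D: "D \<in> carrier_mat n n" "diagonal_mat D" and UD: "B' = U * D * mat_adjoint U" by blast
  \<comment> \<open>\<open>F\<close> extends \<open>U\<close> by a corner entry 1 and
    \<open>G\<close> extends \<open>D\<close> by the eigenvalue \<open>e\<close>; then
    \<open>W * F\<close> diagonalizes \<open>A\<close>.\<close>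
  define F where "F = four_block_mat (1\<^sub>m 1) (0\<^sub>m 1 n) (0\<^sub>m n 1) U"
  define G where "G = four_block_mat E (0\<^sub>m 1 n) (0\<^sub>m n 1) D"
  have F: "F \<in> carrier_mat (Suc n) (Suc n)" and G: "G \<in> carrier_mat (Suc n) (Suc n)"
    using four_block_carrier_mat[of _ 1 1 _ n n] U D E by (auto simp: F_def G_def)
  have Fa: "mat_adjoint F = four_block_mat (1\<^sub>m 1) (0\<^sub>m 1 n) (0\<^sub>m n 1) (mat_adjoint U)"
    unfolding F_def using U by (intro eq_matI) (auto simp: four_block_mat_def)
  have Ua: "mat_adjoint U \<in> carrier_mat n n" using U by simp
  have FF: "mat_adjoint F * F = 1\<^sub>m (Suc n)"
    unfolding Fa unfolding F_def using U four_block_one_mat[of 1 n]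
    by (subst mult_four_block_mat[of _ 1 1 _ n _ n _ _ 1 _ n]) auto
  have dG: "diagonal_mat G"
    unfolding diagonal_mat_def G_def using D E by (auto simp: diagonal_mat_def)
  have BF: "B = F * G * mat_adjoint F"
  proof -
    have "F * G * mat_adjoint F = four_block_mat E (0\<^sub>m 1 n) (0\<^sub>m n 1) B'"
      unfolding Fa unfolding F_def G_def UD using U Ua D E mult_carrier_mat[OF mult_carrier_mat[OF U(1) D(1)] Ua]
      by (simp add: mult_four_block_mat[of _ 1 1 _ n _ n _ _ 1 _ n])
    also have "\<dots> = B"
      by (rule eq_matI) (use B col0 row0 in \<open>auto simp: B'_def E_def\<close>)
    finally show ?thesis by simp
  qed
  have WF: "mat_adjoint (W * F) = mat_adjoint F * Wa"
    using W F by (simp add: mat_adjoint_mult[of _ "Suc n" "Suc n" _ "Suc n"] Wa_def)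
  have Faw: "mat_adjoint F \<in> carrier_mat (Suc n) (Suc n)" using F by simp
  have "mat_adjoint (W * F) * (W * F) = mat_adjoint F * ((Wa * W) * F)"
    unfolding WF using W(1) Wa F Faw
    by (simp add: assoc_mult_mat[of _ "Suc n" "Suc n" _ "Suc n" _ "Suc n"] mult_carrier_mat[of _ "Suc n" "Suc n"])
  then have "mat_adjoint (W * F) * (W * F) = 1\<^sub>m (Suc n)" using F by (simp add: WaW FF)
  moreover have "A = (W * F) * G * mat_adjoint (W * F)"
    unfolding WF AB BF using W(1) Wa F G Faw
    by (simp add: assoc_mult_mat[of _ "Suc n" "Suc n" _ "Suc n" _ "Suc n"] mult_carrier_mat[of _ "Suc n" "Suc n"])
  moreover have "W * F \<in> carrier_mat (Suc n) (Suc n)" using W F by simp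
  ultimately show ?case using G dG
    by (intro exI[of _ "W * F"] exI[of _ G] conjI) assumption+
qed

subsection \<open>The Moore--Penrose inverse\<close>

lemma index_outer_sq:
  assumes "v \<in> carrier_vec n" "a < n" "b < n"
  shows "outer_sq v $$ (a, b) = v $ a * cnj (v $ b)"
    and "(c \<cdot>\<^sub>m outer_sq v) $$ (a, b) = c * (v $ a * cnj (v $ b))"
  using assms by (auto simp: outer_sq_def)

definition real_diag :: "nat \<Rightarrow> (nat \<Rightarrow> real) \<Rightarrow> complex mat" where
  "real_diag n f = mat n n (\<lambda>(i, j). if i = j then complex_of_real (f i) else 0)"

lemma real_diag_carrier [simp]: "real_diag n f \<in> carrier_mat n n"
  by (simp add: real_diag_def)

lemma real_diag_mult: "real_diag n f * real_diag n g = real_diag n (\<lambda>i. f i * g i)"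
proof (rule eq_matI)
  fix i j assume "i < dim_row (real_diag n (\<lambda>i. f i * g i))" "j < dim_col (real_diag n (\<lambda>i. f i * g i))"
  then have ij: "i < n" "j < n" by (simp_all add: real_diag_def)
  have "(real_diag n f * real_diag n g) $$ (i, j) =
      (\<Sum>k<n. if k = i then real_diag n f $$ (i, i) * real_diag n g $$ (i, j) else 0)"
  proof -
    have "(real_diag n f * real_diag n g) $$ (i, j) = (\<Sum>k<n. real_diag n f $$ (i, k) * real_diag n g $$ (k, j))"
      using ij by (simp add: scalar_prod_def atLeast0LessThan real_diag_def)
    also have "\<dots> = (\<Sum>k<n. if k = i then real_diag n f $$ (i, i) * real_diag n g $$ (i, j) else 0)"
      using ij by (intro sum.cong) (auto simp: real_diag_def)
    finally show ?thesis .
  qed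
  also have "\<dots> = real_diag n f $$ (i, i) * real_diag n g $$ (i, j)"
    using ij(1) by simp
  finally show "(real_diag n f * real_diag n g) $$ (i, j) = real_diag n (\<lambda>i. f i * g i) $$ (i, j)"
    using ij by (simp add: real_diag_def)
qed (simp_all add: real_diag_def)

lemma index_conj_real_diag:
  assumes U: "U \<in> carrier_mat n n" and ab: "a < n" "b < n"
  shows "(U * real_diag n f * mat_adjoint U) $$ (a, b) =
    (\<Sum>i<n. complex_of_real (f i) * (U $$ (a, i) * cnj (U $$ (b, i))))"
proof -
  have "(U * real_diag n f) $$ (a, i) = complex_of_real (f i) * U $$ (a, i)" if "i < n" for i
  proof -
    have "(U * real_diag n f) $$ (a, i) = (\<Sum>k<n. if k = i then complex_of_real (f i) * U $$ (a, i) else 0)"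
    proof -
      have "(U * real_diag n f) $$ (a, i) = (\<Sum>k<n. U $$ (a, k) * real_diag n f $$ (k, i))"
        using U ab that by (simp add: scalar_prod_def atLeast0LessThan real_diag_def)
      also have "\<dots> = (\<Sum>k<n. if k = i then complex_of_real (f i) * U $$ (a, i) else 0)"
        using that by (intro sum.cong) (auto simp: real_diag_def)
      finally show ?thesis .
    qed
    then show ?thesis using that by simp
  qed
  then show ?thesis
    using U ab by (simp add: scalar_prod_def atLeast0LessThan mult.assoc real_diag_def)
qed

text \<open>Terms with \<open>f i = 0\<close> contribute nothing, so the restricted sum in the
  definition of \<open>pinv\<close> is still a product with a full diagonal matrix.\<close>

lemma sum_mats_outer_sq:
  assumes "\<And>i. i < n \<Longrightarrow> u i \<in> carrier_vec n"
  defines "U \<equiv> mat n n (\<lambda>(a, i). u i $ a)"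
  shows "sum_mats n (\<lambda>i. complex_of_real (f i) \<cdot>\<^sub>m outer_sq (u i)) {i. i < n \<and> f i \<noteq> 0} =
    U * real_diag n f * mat_adjoint U"
proof (rule eq_matI)
  have U: "U \<in> carrier_mat n n" by (simp add: U_def)
  fix a b assume "a < dim_row (U * real_diag n f * mat_adjoint U)"
    "b < dim_col (U * real_diag n f * mat_adjoint U)"
  then have ab: "a < n" "b < n" by (simp_all add: U_def)
  have "(\<Sum>i\<in>{i. i < n \<and> f i \<noteq> 0}. (complex_of_real (f i) \<cdot>\<^sub>m outer_sq (u i)) $$ (a, b)) =
      (\<Sum>i<n. complex_of_real (f i) * (U $$ (a, i) * cnj (U $$ (b, i))))"
    using assms(1) ab by (intro sum.mono_neutral_cong_left) (auto simp: index_outer_sq[of _ n] U_def)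
  then show "sum_mats n (\<lambda>i. complex_of_real (f i) \<cdot>\<^sub>m outer_sq (u i)) {i. i < n \<and> f i \<noteq> 0} $$ (a, b) =
      (U * real_diag n f * mat_adjoint U) $$ (a, b)"
    using ab by (simp add: sum_mats_def index_conj_real_diag[OF U])
qed (simp_all add: sum_mats_def U_def)

lemma sum_mats_outer_sq_all:
  assumes "\<And>i. i < n \<Longrightarrow> u i \<in> carrier_vec n"
  shows "sum_mats n (\<lambda>i. complex_of_real (f i) \<cdot>\<^sub>m outer_sq (u i)) {..<n} =
    sum_mats n (\<lambda>i. complex_of_real (f i) \<cdot>\<^sub>m outer_sq (u i)) {i. i < n \<and> f i \<noteq> 0}"
proof -
  have "(\<Sum>i<n. (complex_of_real (f i) \<cdot>\<^sub>m outer_sq (u i)) $$ (a, b)) =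
      (\<Sum>i\<in>{i. i < n \<and> f i \<noteq> 0}. (complex_of_real (f i) \<cdot>\<^sub>m outer_sq (u i)) $$ (a, b))"
    if "a < n" "b < n" for a b
    using assms that by (intro sum.mono_neutral_cong_right) (auto simp: index_outer_sq[of _ n])
  then show ?thesis by (intro eq_matI) (simp_all add: sum_mats_def)
qed

text \<open>The inner products of the \<open>u i\<close> are the entries of
  \<open>mat_adjoint (U u) * U u\<close>, so orthonormality is a matrix equation and decompositions
  can be handled by matrix algebra.\<close>

lemma spectral_decomp_iff:
  assumes "dim_row H = n"
  defines "U u \<equiv> mat n n (\<lambda>(a, i). u i $ a)"
  shows "spectral_decomp H l u \<longleftrightarrow> (\<forall>i<n. u i \<in> carrier_vec n) \<and>
    mat_adjoint (U u) * U u = 1\<^sub>m n \<and> H = U u * real_diag n l * mat_adjoint (U u)"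
proof (cases "\<forall>i<n. u i \<in> carrier_vec n")
  case True
  have "mat_adjoint (U u) * U u = 1\<^sub>m n \<longleftrightarrow>
      (\<forall>i<n. \<forall>j<n. (mat_adjoint (U u) * U u) $$ (i, j) = (if i = j then 1 else 0))"
  proof
    show "mat_adjoint (U u) * U u = 1\<^sub>m n"
      if "\<forall>i<n. \<forall>j<n. (mat_adjoint (U u) * U u) $$ (i, j) = (if i = j then 1 else 0)"
      using that by (intro eq_matI) (simp_all add: U_def del: index_mult_mat(1))
  qed (simp del: index_mult_mat(1))
  also have "\<dots> \<longleftrightarrow> (\<forall>i<n. \<forall>j<n. herm_inner (u i) (u j) = (if i = j then 1 else 0))"
  proof -
    have "(mat_adjoint (U u) * U u) $$ (i, j) = herm_inner (u i) (u j)" if "i < n" "j < n" for i j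
    proof -
      have "dim_vec (u i) = n" "dim_vec (u j) = n" using True that by (simp_all add: carrier_vecD)
      then show ?thesis using that by (simp add: U_def herm_inner_def scalar_prod_def)
    qed
    then show ?thesis by simp
  qed
  finally show ?thesis
    using True sum_mats_outer_sq[of n u l] sum_mats_outer_sq_all[of n u l] assms(1)
    by (simp add: spectral_decomp_def Let_def U_def)
next
  case False
  then show ?thesis using assms(1) by (auto simp: spectral_decomp_def Let_def)
qed

text \<open>Diagonalization gives complex diagonal entries, while \<open>spectral_decomp\<close>
  asks for real ones. They are real because \<open>D = V * (A * U)\<close>, with \<open>V\<close>
  the adjoint of \<open>U\<close>, is again Hermitian.\<close>

lemma hermitian_spectral_decomp:
  assumes A: "A \<in> carrier_mat n n" "mat_adjoint A = A"
  shows "\<exists>l u. spectral_decomp A l u"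
proof -
  obtain U D where U: "U \<in> carrier_mat n n" "mat_adjoint U * U = 1\<^sub>m n"
    and D: "D \<in> carrier_mat n n" "diagonal_mat D" and AD: "A = U * D * mat_adjoint U"
    using hermitian_diagonalization[OF A] by blast
  define V where "V = mat_adjoint U"
  have V: "V \<in> carrier_mat n n" using U by (simp add: V_def)
  have DA: "D = V * (A * U)"
  proof -
    have "V * (A * U) = (V * U) * (D * (V * U))"
      unfolding AD V_def[symmetric] using U(1) V D(1)
      by (simp add: assoc_mult_mat[of _ n n _ n _ n] mult_carrier_mat[of _ n n _ n])
    then show ?thesis using U D by (simp add: V_def)
  qed
  have "mat_adjoint D = D"
  proof -
    have "mat_adjoint D = mat_adjoint (A * U) * mat_adjoint V"
      unfolding DA by (rule mat_adjoint_mult[OF V]) (use A U in auto)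
    also have "mat_adjoint (A * U) = V * A"
      using mat_adjoint_mult[OF A(1) U(1)] A(2) by (simp add: V_def)
    also have "mat_adjoint V = U" by (simp add: V_def)
    also have "V * A * U = D" unfolding DA by (rule assoc_mult_mat[OF V A(1) U(1)])
    finally show ?thesis .
  qed
  then have "cnj (D $$ (i, i)) = D $$ (i, i)" if "i < n" for i
    using that D(1) index_mat_adjoint[of i D i] by simp
  then have re: "complex_of_real (Re (D $$ (i, i))) = D $$ (i, i)" if "i < n" for i
    using that by (simp add: complex_eq_iff)
  have "D = real_diag n (\<lambda>i. Re (D $$ (i, i)))"
    using D re by (intro eq_matI) (auto simp: real_diag_def diagonal_mat_def)
  moreover have "mat n n (\<lambda>(a, i). col U i $ a) = U"
    using U(1) by (intro eq_matI) simp_all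
  moreover have "\<forall>i<n. col U i \<in> carrier_vec n"
    using U(1) by (auto intro: carrier_vecI)
  ultimately have "spectral_decomp A (\<lambda>i. Re (D $$ (i, i))) (col U)"
    using spectral_decomp_iff[OF carrier_matD(1)[OF A(1)], of "\<lambda>i. Re (D $$ (i, i))" "col U"] AD U(2)
    by simp
  then show ?thesis by blast
qed

text \<open>Commuting pseudo-inverses are unique: both products \<open>H P\<close> and \<open>H Q\<close> equal \<open>H P H Q\<close>.\<close>

lemma group_inverse_unique:
  fixes H :: "'a :: comm_ring_1 mat"
  assumes car: "H \<in> carrier_mat n n" "P \<in> carrier_mat n n" "Q \<in> carrier_mat n n"
    and P: "H * P * H = H" "P * H * P = P" "H * P = P * H"
    and Q: "H * Q * H = H" "Q * H * Q = Q" "H * Q = Q * H"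
  shows "P = Q"
proof -
  note assoc = assoc_mult_mat[of _ n n _ n _ n] mult_carrier_mat[of _ n n _ n]
  have "H * P = (P * H) * (Q * H)"
    using car P(3) Q(1) by (simp add: assoc)
  also have "\<dots> = (H * P) * (H * Q)" by (simp only: P(3) Q(3))
  also have "\<dots> = (H * P * H) * Q" using car by (simp add: assoc)
  finally have HPQ: "H * P = H * Q" by (simp only: P(1))
  \<comment> \<open>\<open>P * H\<close> and \<open>Q * H\<close> agree, so the outer factors of
    \<open>P * H * P\<close> can be exchanged for \<open>Q\<close> one at a time.\<close>
  have "P = (P * H) * P" using P(2) by simp
  also have "\<dots> = (Q * H) * P" by (simp only: HPQ flip: P(3) Q(3))
  also have "\<dots> = Q * (H * P)" using car by (simp add: assoc)
  also have "\<dots> = Q * H * Q" unfolding HPQ using car by (simp add: assoc)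
  finally show ?thesis using Q(2) by simp
qed

text \<open>Every spectral decomposition yields a matrix satisfying the equations in
  \<open>G\<close>, and these determine it. So the description under \<open>THE\<close> has exactly
  one solution, and \<open>pinv A\<close> inherits the equations.\<close>

lemma pinv_hermitian:
  assumes A: "A \<in> carrier_mat n n" "mat_adjoint A = A"
  shows pinv_carrier: "pinv A \<in> carrier_mat n n"
    and mult_pinv_mult: "A * pinv A * A = A"
    and pinv_commute: "A * pinv A = pinv A * A"
proof -
  define G where "G P \<longleftrightarrow> P \<in> carrier_mat n n \<and> A * P * A = A \<and> P * A * P = P \<and> A * P = P * A" for P
  define R where "R P \<longleftrightarrow> (\<exists>l u. spectral_decomp A l u \<and>
     P = sum_mats (dim_row A) (\<lambda>i. complex_of_real (1 / l i) \<cdot>\<^sub>m outer_sq (u i))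
           {i. i < dim_row A \<and> l i \<noteq> 0})" for P
  have RG: "G P" if R: "R P" for P
  proof -
    \<comment> \<open>The index set is written with \<open>1 / l i \<noteq> 0\<close>, the shape of
      \<open>sum_mats_outer_sq\<close> for the reciprocals.\<close>
    from R obtain l u where lu: "spectral_decomp A l u" and
      P: "P = sum_mats n (\<lambda>i. complex_of_real (1 / l i) \<cdot>\<^sub>m outer_sq (u i)) {i. i < n \<and> 1 / l i \<noteq> 0}"
      using A(1) by (auto simp: R_def)
    define U where "U = mat n n (\<lambda>(a, i). u i $ a)"
    define V where "V = mat_adjoint U"
    have UV: "U \<in> carrier_mat n n" "V \<in> carrier_mat n n" by (simp_all add: U_def V_def)
    have VU: "V * U = 1\<^sub>m n" and AU: "A = U * real_diag n l * V"
      and u: "\<And>i. i < n \<Longrightarrow> u i \<in> carrier_vec n"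
      using lu A(1) spectral_decomp_iff[of A n l u] by (auto simp: U_def V_def)
    have PU: "P = U * real_diag n (\<lambda>i. 1 / l i) * V"
      unfolding P by (subst sum_mats_outer_sq[OF u]) (simp_all add: U_def V_def)
    note mult = conj_mult_conj[OF UV real_diag_carrier real_diag_carrier VU]
    show ?thesis unfolding G_def
    proof (intro conjI)
      show "P \<in> carrier_mat n n" unfolding PU using UV by (simp add: mult_carrier_mat[of _ n n _ n])
      \<comment> \<open>By the convention \<open>1 / 0 = 0\<close> these identities also hold at the
        eigenvalue 0.\<close>
      have "l i * (1 / l i) * l i = l i" "1 / l i * l i * (1 / l i) = 1 / l i" for i by simp_all
      then show "A * P * A = A" "P * A * P = P"
        unfolding AU PU mult real_diag_mult by presburger+
      show "A * P = P * A" unfolding AU PU mult real_diag_mult by (simp add: mult.commute)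
    qed
  qed
  have "\<exists>P. R P" using hermitian_spectral_decomp[OF A] by (auto simp: R_def)
  moreover have "P = Q" if "R P" "R Q" for P Q
    using group_inverse_unique[OF A(1), of P Q] RG[OF that(1)] RG[OF that(2)] unfolding G_def by blast
  ultimately have "\<exists>!P. R P" by blast
  then have "R (THE P. R P)" by (rule theI')
  moreover have "(THE P. R P) = pinv A" by (simp only: pinv_def R_def)
  ultimately have "G (pinv A)" using RG by metis
  then show "pinv A \<in> carrier_mat n n" "A * pinv A * A = A" "A * pinv A = pinv A * A"
    unfolding G_def by blast+
qed

subsection \<open>The Frobenius inner product\<close>

text \<open>Matrices enter as functions of two indices, so that sums and differences are pointwise;
  only indices below \<open>r\<close> count.\<close>

definition frob :: "nat \<Rightarrow> (nat \<Rightarrow> nat \<Rightarrow> complex) \<Rightarrow> (nat \<Rightarrow> nat \<Rightarrow> complex) \<Rightarrow> complex" where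
  "frob r F G = (\<Sum>a<r. \<Sum>b<r. cnj (F a b) * G a b)"

lemma frob_cong:
  assumes "\<And>a b. a < r \<Longrightarrow> b < r \<Longrightarrow> F a b = F' a b" "\<And>a b. a < r \<Longrightarrow> b < r \<Longrightarrow> G a b = G' a b"
  shows "frob r F G = frob r F' G'"
  using assms by (simp add: frob_def)

lemma cnj_frob: "cnj (frob r F G) = frob r G F"
  by (simp add: frob_def mult.commute)

lemma frob_self: "frob r F F = complex_of_real (\<Sum>a<r. \<Sum>b<r. (cmod (F a b))\<^sup>2)"
  unfolding frob_def of_real_sum complex_norm_square by (simp add: mult.commute)

text \<open>In the order on the complex numbers this includes that the value is real. Both
  inequalities of the theorem come from it.\<close>

lemma frob_self_nonneg: "0 \<le> frob r F F"
  unfolding frob_self less_eq_complex_def by (simp add: sum_nonneg)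

lemma frob_self_eq_0_iff: "frob r F F = 0 \<longleftrightarrow> (\<forall>a<r. \<forall>b<r. F a b = 0)"
  unfolding frob_self of_real_eq_0_iff by (auto simp: sum_nonneg_eq_0_iff sum_nonneg)

lemma frob_diff_right: "frob r F (\<lambda>a b. G a b - c * H a b) = frob r F G - c * frob r F H"
  by (simp add: frob_def sum_subtractf sum_distrib_left algebra_simps)

lemma frob_diff_left: "frob r (\<lambda>a b. F a b - c * H a b) G = frob r F G - cnj c * frob r H G"
  by (simp add: frob_def sum_subtractf sum_distrib_left algebra_simps)

text \<open>The double sum factors into \<open>herm_inner u w\<close> and its conjugate. This turns
  the Hadamard square of a Gram matrix into a Gram matrix of rank one matrices.\<close>

lemma frob_outer:
  assumes "u \<in> carrier_vec r" "w \<in> carrier_vec r"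
  shows "frob r (\<lambda>a b. u $ a * cnj (u $ b)) (\<lambda>a b. w $ a * cnj (w $ b)) =
    complex_of_real ((cmod (herm_inner u w))\<^sup>2)"
proof -
  have h: "herm_inner u w = (\<Sum>a<r. cnj (u $ a) * w $ a)"
    using assms by (simp add: herm_inner_def scalar_prod_def atLeast0LessThan)
  have "frob r (\<lambda>a b. u $ a * cnj (u $ b)) (\<lambda>a b. w $ a * cnj (w $ b)) =
      (\<Sum>a<r. \<Sum>b<r. (cnj (u $ a) * w $ a) * cnj (cnj (u $ b) * w $ b))"
    unfolding frob_def by (intro sum.cong refl) (simp add: mult_ac)
  also have "\<dots> = herm_inner u w * cnj (herm_inner u w)"
    unfolding h cnj_sum sum_product ..
  finally show ?thesis unfolding complex_norm_square .
qed

section \<open>A family of unit vectors and its rank one matrices\<close>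

locale unit_family =
  fixes n r :: nat and v :: "nat \<Rightarrow> complex vec"
  assumes dim: "i < n \<Longrightarrow> v i \<in> carrier_vec r"
    and unit: "i < n \<Longrightarrow> herm_inner (v i) (v i) = 1"
begin

definition outer :: "nat \<Rightarrow> nat \<Rightarrow> nat \<Rightarrow> complex" where
  "outer i a b = v i $ a * cnj (v i $ b)"

definition comb :: "(nat \<Rightarrow> complex) \<Rightarrow> nat \<Rightarrow> nat \<Rightarrow> complex" where
  "comb x a b = (\<Sum>i<n. x i * outer i a b)"

definition idm :: "nat \<Rightarrow> nat \<Rightarrow> complex" where
  "idm a b = (if a = b then 1 else 0)"

definition A :: "complex mat" where
  "A = hadamard (gram_mat n v) (map_mat cnj (gram_mat n v))"

lemma A_carrier [simp]: "A \<in> carrier_mat n n"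
  by (simp add: A_def hadamard_def gram_mat_def)

lemma index_A_cmod:
  assumes "i < n" "j < n"
  shows "A $$ (i, j) = complex_of_real ((cmod (herm_inner (v i) (v j)))\<^sup>2)"
  unfolding complex_norm_square using assms by (simp add: A_def hadamard_def gram_mat_def)

lemma index_A:
  assumes "i < n" "j < n"
  shows "A $$ (i, j) = frob r (outer i) (outer j)"
  using frob_outer[OF dim dim, OF assms] index_A_cmod[OF assms] by (simp add: outer_def[abs_def])

lemma adjoint_A: "mat_adjoint A = A"
proof (rule eq_matI)
  fix i j assume "i < dim_row A" "j < dim_col A"
  then have ij: "i < n" "j < n" by (simp_all add: carrier_matD[OF A_carrier])
  then have "mat_adjoint A $$ (i, j) = cnj (A $$ (j, i))"
    by (simp add: carrier_matD[OF A_carrier])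
  then show "mat_adjoint A $$ (i, j) = A $$ (i, j)"
    using ij by (simp only: index_A cnj_frob)
qed (simp_all add: carrier_matD[OF A_carrier])

lemma comb_diff: "comb (\<lambda>i. x i - c * y i) = (\<lambda>a b. comb x a b - c * comb y a b)"
  by (intro ext) (simp add: comb_def sum_subtractf sum_distrib_left algebra_simps)

lemma frob_comb_right: "frob r F (comb x) = (\<Sum>i<n. x i * frob r F (outer i))"
proof -
  have "frob r F (comb x) = (\<Sum>a<r. \<Sum>b<r. \<Sum>i<n. x i * (cnj (F a b) * outer i a b))"
    by (simp add: frob_def comb_def sum_distrib_left mult.left_commute)
  also have "\<dots> = (\<Sum>a<r. \<Sum>i<n. \<Sum>b<r. x i * (cnj (F a b) * outer i a b))"
    by (intro sum.cong refl sum.swap)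
  also have "\<dots> = (\<Sum>i<n. \<Sum>a<r. \<Sum>b<r. x i * (cnj (F a b) * outer i a b))"
    by (rule sum.swap)
  finally show ?thesis by (simp add: frob_def sum_distrib_left)
qed

lemma frob_comb_left: "frob r (comb x) G = (\<Sum>i<n. cnj (x i) * frob r (outer i) G)"
proof -
  have "frob r (comb x) G = cnj (frob r G (comb x))" by (rule cnj_frob[symmetric])
  then show ?thesis by (simp add: frob_comb_right cnj_frob)
qed

text \<open>The left side is the trace of \<open>outer i\<close>, which is the squared norm of
  \<open>v i\<close>. Here the unit length of the vectors enters.\<close>

lemma frob_idm_outer:
  assumes "i < n"
  shows "frob r idm (outer i) = 1"
proof -
  have "frob r idm (outer i) = (\<Sum>a<r. \<Sum>b<r. if b = a then cnj (v i $ a) * v i $ a else 0)"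
    unfolding frob_def by (intro sum.cong refl) (simp add: idm_def outer_def)
  also have "\<dots> = herm_inner (v i) (v i)"
    using dim[OF assms] by (simp add: herm_inner_def scalar_prod_def atLeast0LessThan)
  finally show ?thesis using unit[OF assms] by simp
qed

lemma frob_outer_idm: "i < n \<Longrightarrow> frob r (outer i) idm = 1"
  using frob_idm_outer[of i] cnj_frob[of r idm "outer i"] by simp

lemma frob_idm_comb: "frob r idm (comb x) = (\<Sum>i<n. x i)"
  by (simp add: frob_comb_right frob_idm_outer)

lemma frob_idm: "frob r idm idm = of_nat r"
proof -
  have "frob r idm idm = (\<Sum>a<r. \<Sum>b<r. if b = a then 1 else 0)"
    unfolding frob_def by (intro sum.cong refl) (simp add: idm_def)
  then show ?thesis by simp
qed

text \<open>Linear systems become geometry: \<open>A x = 1\<close> says that \<open>comb\<close> of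
  \<open>x\<close> has inner product 1 with every \<open>outer i\<close>, just as the identity
  has.\<close>

lemma frob_outer_comb:
  assumes "i < n" "x \<in> carrier_vec n"
  shows "frob r (outer i) (comb (($) x)) = (A *\<^sub>v x) $ i"
proof -
  have "(A *\<^sub>v x) $ i = (\<Sum>j<n. A $$ (i, j) * x $ j)"
    using assms carrier_matD[OF A_carrier] by (simp add: scalar_prod_def atLeast0LessThan)
  then show ?thesis
    using assms by (simp add: frob_comb_right index_A mult.commute)
qed

text \<open>If \<open>A x = 0\<close> then \<open>\<Sum> x\<^sub>i v\<^sub>i v\<^sub>i\<^sup>* = 0\<close>, and its trace is \<open>\<Sum> x\<^sub>i\<close>; so the all ones
  vector is orthogonal to the kernel of \<open>A\<close>.\<close>

lemma A_mult_pinv_ones: "A *\<^sub>v (pinv A *\<^sub>v ones_vec n) = ones_vec n"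
proof -
  note P = pinv_hermitian[OF A_carrier adjoint_A]
  have one: "ones_vec n \<in> carrier_vec n" by (simp add: ones_vec_def)
  define w where "w = pinv A *\<^sub>v ones_vec n"
  have w: "w \<in> carrier_vec n" using P(1) one by (simp add: w_def)
  \<comment> \<open>\<open>x\<close> is the part of the all ones vector that \<open>A w\<close>
    misses. It lies in the kernel of \<open>A\<close>, and the aim is to show that it is orthogonal
    to itself.\<close>
  define x where "x = ones_vec n - A *\<^sub>v w"
  have Aw: "A *\<^sub>v w \<in> carrier_vec n" using w by (rule mult_mat_vec_carrier[OF A_carrier])
  then have x: "x \<in> carrier_vec n" using one by (simp add: x_def)
  have xi: "x $ i = 1 - (A *\<^sub>v w) $ i" if "i < n" for i
    unfolding x_def using that carrier_vecD[OF Aw]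
    by (simp add: ones_vec_def carrier_matD[OF A_carrier] del: index_mult_mat_vec)
  \<comment> \<open>As \<open>A\<close> commutes with \<open>pinv A\<close>, the product
    \<open>A * (A * pinv A)\<close> is \<open>A\<close> again; hence \<open>A x = 0\<close>.\<close>
  have "A *\<^sub>v (A *\<^sub>v w) = (A * (A * pinv A)) *\<^sub>v ones_vec n"
    unfolding w_def using P(1) one
    by (simp add: assoc_mult_mat_vec[of _ n n _ n] mult_carrier_mat[OF A_carrier] mult_mat_vec_carrier[OF P(1)])
  also have "A * (A * pinv A) = A"
    using assoc_mult_mat[OF A_carrier P(1) A_carrier] P(2,3) by metis
  finally have "A *\<^sub>v x = 0\<^sub>v n"
    unfolding x_def using mult_minus_distrib_mat_vec[OF A_carrier one Aw] mult_mat_vec_carrier[OF A_carrier one]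
    by simp
  then have "frob r (outer i) (comb (($) x)) = 0" if "i < n" for i
    using frob_outer_comb[OF that x] that by simp
  then have "frob r (comb (($) x)) (comb (($) x)) = 0"
    by (simp add: frob_comb_left)
  then have 0: "\<forall>a<r. \<forall>b<r. comb (($) x) a b = 0" by (simp add: frob_self_eq_0_iff)
  \<comment> \<open>Take for \<open>G\<close> the identity and \<open>comb\<close> of
    \<open>w\<close>: then \<open>x\<close> is orthogonal to the all ones vector and to
    \<open>A w\<close>, hence to their difference, which is \<open>x\<close>.\<close>
  then have "frob r (comb (($) x)) G = 0" for G by (simp add: frob_def)
  moreover have "frob r (comb (($) x)) idm = (\<Sum>i<n. cnj (x $ i))"
    by (simp add: frob_comb_left frob_outer_idm)
  moreover have "frob r (comb (($) x)) (comb (($) w)) = (\<Sum>i<n. cnj (x $ i) * (A *\<^sub>v w) $ i)"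
    by (simp add: frob_comb_left frob_outer_comb[OF _ w] del: index_mult_mat_vec)
  ultimately have "(\<Sum>i<n. cnj (x $ i) * (1 - (A *\<^sub>v w) $ i)) = 0"
    by (simp add: algebra_simps sum_subtractf del: index_mult_mat_vec)
  also have "(\<Sum>i<n. cnj (x $ i) * (1 - (A *\<^sub>v w) $ i)) = (\<Sum>i<n. complex_of_real ((cmod (x $ i))\<^sup>2))"
    unfolding complex_norm_square by (intro sum.cong) (simp_all add: mult.commute flip: xi)
  also have "\<dots> = complex_of_real (\<Sum>i<n. (cmod (x $ i))\<^sup>2)" by simp
  finally have "\<forall>i<n. x $ i = 0"
    unfolding of_real_eq_0_iff by (auto simp: sum_nonneg_eq_0_iff)
  then have "\<forall>i<n. (A *\<^sub>v w) $ i = ones_vec n $ i"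
    using xi by (simp add: ones_vec_def del: index_mult_mat_vec)
  then show ?thesis
    using Aw one unfolding w_def[symmetric] by (intro eq_vecI) (auto simp: carrier_matD[OF A_carrier] simp del: index_mult_mat_vec)
qed

text \<open>The combinations form a submodule containing the generators, which gives one inclusion;
  the other follows by adding the terms one at a time. Coefficients belong to indices, so repeated
  vectors do no harm.\<close>

lemma mat_span_outer_sq:
  "mat_span r {outer_sq (v i) | i. i < n} = {mat r r (\<lambda>(a, b). comb c a b) | c. True}" (is "?L = ?N")
proof -
  interpret matrix_vs r r "TYPE(complex)" .
  let ?S = "{outer_sq (v i) | i. i < n}"
  have outer: "outer_sq (v i) = mat r r (\<lambda>(a, b). outer i a b)" if "i < n" for i
    using dim[OF that] by (auto simp: outer_sq_def outer_def)
  have S: "?S \<subseteq> carrier_mat r r" using outer by auto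
  have addN: "mat r r (\<lambda>(a, b). comb c a b) + mat r r (\<lambda>(a, b). comb d a b) =
      mat r r (\<lambda>(a, b). comb (\<lambda>i. c i + d i) a b)" for c d
    by (intro eq_matI) (simp_all add: comb_def sum.distrib algebra_simps)
  have smultN: "k \<cdot>\<^sub>m mat r r (\<lambda>(a, b). comb c a b) = mat r r (\<lambda>(a, b). comb (\<lambda>i. k * c i) a b)" for k c
    by (intro eq_matI) (simp_all add: comb_def sum_distrib_left algebra_simps)
  have zeroN: "0\<^sub>m r r = mat r r (\<lambda>(a, b). comb (\<lambda>_. 0) a b)"
    by (intro eq_matI) (simp_all add: comb_def)
  have "LinearCombinations.submodule class_ring ?N V"
    unfolding LinearCombinations.submodule_def module_mat_simps
    using module_axioms addN smultN zeroN by auto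
  moreover have "?S \<subseteq> ?N"
  proof
    fix X assume "X \<in> ?S"
    then obtain i where i: "i < n" "X = outer_sq (v i)" by blast
    then have "X = mat r r (\<lambda>(a, b). comb (\<lambda>j. if j = i then 1 else 0) a b)"
      by (simp add: outer comb_def if_distrib[of "\<lambda>x. x * _"] cong: if_cong)
    then show "X \<in> ?N" by blast
  qed
  ultimately have "?L \<subseteq> ?N" by (rule span_is_subset[rotated])
  have sub: "LinearCombinations.submodule class_ring (span ?S) V"
    using span_is_submodule S by blast
  have partial: "m \<le> n \<Longrightarrow> mat r r (\<lambda>(a, b). \<Sum>i<m. c i * outer i a b) \<in> span ?S" for m c
  proof (induction m)
    case 0
    have zero: "mat r r (\<lambda>(a, b). \<Sum>i<0::nat. c i * outer i a b) = 0\<^sub>m r r" by (intro eq_matI) auto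
    show ?case
      using sub unfolding zero LinearCombinations.submodule_def module_mat_simps by blast
  next
    case (Suc m)
    have "mat r r (\<lambda>(a, b). \<Sum>i<Suc m. c i * outer i a b) =
        mat r r (\<lambda>(a, b). \<Sum>i<m. c i * outer i a b) + c m \<cdot>\<^sub>m outer_sq (v m)"
      using Suc.prems by (intro eq_matI) (auto simp: outer)
    moreover have "outer_sq (v m) \<in> span ?S"
    proof -
      have "outer_sq (v m) \<in> ?S" using Suc.prems by auto
      then show ?thesis using in_own_span[of ?S] S by blast
    qed
    moreover have "mat r r (\<lambda>(a, b). \<Sum>i<m. c i * outer i a b) \<in> span ?S"
      using Suc by simp
    ultimately show ?case
      using sub unfolding LinearCombinations.submodule_def module_mat_simps class_ring_simps by simp
  qed
  have "?N \<subseteq> ?L" using partial[of n] by (auto simp: comb_def)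
  with \<open>?L \<subseteq> ?N\<close> show ?thesis by blast
qed

lemma one_in_mat_span_iff:
  "1\<^sub>m r \<in> mat_span r {outer_sq (v i) | i. i < n} \<longleftrightarrow> (\<exists>c. \<forall>a<r. \<forall>b<r. idm a b = comb c a b)"
proof -
  have "1\<^sub>m r = mat r r (\<lambda>(a, b). comb c a b) \<longleftrightarrow> (\<forall>a<r. \<forall>b<r. idm a b = comb c a b)" for c
    by (auto simp: mat_eq_iff idm_def)
  then show ?thesis unfolding mat_span_outer_sq by auto
qed

section \<open>The identity and its projection: the upper bound \<open>r\<close>\<close>

context
  fixes w :: "nat \<Rightarrow> complex"
  assumes w: "i < n \<Longrightarrow> frob r (outer i) (comb w) = 1"
begin

text \<open>The right side is also the inner product of \<open>comb x\<close> with the identity, so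
  \<open>comb w\<close> is the orthogonal projection of the identity to the span of the
  \<open>outer i\<close>.\<close>

lemma frob_comb_solution: "frob r (comb x) (comb w) = (\<Sum>i<n. cnj (x i))"
  by (simp add: frob_comb_left w)

text \<open>The case \<open>x = w\<close>, conjugated. Being a squared norm, the sum of the
  \<open>w i\<close> is real.\<close>

lemma sum_solution: "frob r (comb w) (comb w) = (\<Sum>i<n. w i)"
  using arg_cong[OF frob_comb_solution[of w], of cnj] by (simp add: cnj_frob)

lemma frob_solution_idm: "frob r (comb w) idm = (\<Sum>i<n. w i)"
  using cnj_frob[of r "comb w" "comb w"] cnj_frob[of r idm "comb w"]
  by (simp only: sum_solution frob_idm_comb)

text \<open>Of the four terms in the expansion, the three involving \<open>comb w\<close> all equal
  the sum of the \<open>w i\<close>, with signs minus, minus, plus.\<close>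

lemma frob_idm_diff:
  "frob r (\<lambda>a b. idm a b - comb w a b) (\<lambda>a b. idm a b - comb w a b) = of_nat r - (\<Sum>i<n. w i)"
  using frob_diff_left[of r idm 1 "comb w"] frob_diff_right[of r _ idm 1 "comb w"]
  by (simp add: frob_idm frob_idm_comb sum_solution frob_solution_idm)

lemma sum_solution_le: "(\<Sum>i<n. w i) \<le> of_nat r"
  using frob_self_nonneg[of r "\<lambda>a b. idm a b - comb w a b"]
  unfolding frob_idm_diff diff_ge_0_iff_ge .

text \<open>Equality makes the identity coincide with its projection. Conversely, if the identity is
  a combination, then \<open>?D\<close> lies in the span and is orthogonal to it, hence is
  zero.\<close>

lemma sum_solution_eq_iff:
  "(\<Sum>i<n. w i) = of_nat r \<longleftrightarrow> (\<exists>c. \<forall>a<r. \<forall>b<r. idm a b = comb c a b)"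
proof
  assume "(\<Sum>i<n. w i) = of_nat r"
  then have "\<forall>a<r. \<forall>b<r. idm a b - comb w a b = 0"
    using frob_self_eq_0_iff[of r "\<lambda>a b. idm a b - comb w a b"] unfolding frob_idm_diff by simp
  then show "\<exists>c. \<forall>a<r. \<forall>b<r. idm a b = comb c a b" by auto
next
  assume "\<exists>c. \<forall>a<r. \<forall>b<r. idm a b = comb c a b"
  then obtain c where c: "\<forall>a<r. \<forall>b<r. idm a b = comb c a b" ..
  let ?D = "\<lambda>a b. idm a b - comb w a b"
  \<comment> \<open>Only the first argument is rewritten as a combination; the factor 1 fits the
    form of \<open>comb_diff\<close>.\<close>
  have "frob r ?D ?D = frob r (comb (\<lambda>i. c i - 1 * w i)) ?D"
    unfolding comb_diff by (intro frob_cong) (use c in auto)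
  also have "\<dots> = 0"
    unfolding frob_comb_left using frob_diff_right[of r _ idm 1 "comb w"]
    by (simp add: frob_outer_idm w)
  finally show "(\<Sum>i<n. w i) = of_nat r" unfolding frob_idm_diff by simp
qed

section \<open>The lower bound for the sum of squared inner products\<close>

context
  assumes n_pos: "n \<ge> 1"
begin

text \<open>Otherwise \<open>comb w\<close> would vanish and could not have inner product 1 with
  \<open>outer 0\<close>, which exists because \<open>n \<ge> 1\<close>. This permits division by
  the sum.\<close>

lemma sum_solution_nonzero: "(\<Sum>i<n. w i) \<noteq> 0"
proof
  assume "(\<Sum>i<n. w i) = 0"
  then have "\<forall>a<r. \<forall>b<r. comb w a b = 0"
    by (simp add: frob_self_eq_0_iff flip: sum_solution)
  then have "frob r (outer 0) (comb w) = 0" by (simp add: frob_def)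
  then show False using w[of 0] n_pos by simp
qed

text \<open>The inner product of \<open>comb (\<lambda>_. 1)\<close> and \<open>comb w\<close> is
  \<open>n\<close>, so \<open>k\<close> is the coefficient of the projection of the former to the
  latter, and \<open>F\<close> is what remains.\<close>

lemma frob_residual:
  defines "k \<equiv> of_nat n / (\<Sum>i<n. w i)"
  defines "F \<equiv> comb (\<lambda>i. 1 - k * w i)"
  shows "frob r F F = frob r (comb (\<lambda>_. 1)) (comb (\<lambda>_. 1)) - (of_nat n)\<^sup>2 / (\<Sum>i<n. w i)"
proof -
  \<comment> \<open>The sum is a squared norm, hence real; so \<open>k\<close> is real and both
    mixed terms agree.\<close>
  have "cnj (\<Sum>i<n. w i) = (\<Sum>i<n. w i)"
    using cnj_frob[of r "comb w" "comb w"] by (simp only: sum_solution)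
  then have k: "cnj k = k" by (simp add: k_def)
  have 1: "frob r (comb (\<lambda>_. 1)) (comb w) = of_nat n" by (simp add: frob_comb_solution)
  then have 2: "frob r (comb w) (comb (\<lambda>_. 1)) = of_nat n"
    using cnj_frob[of r "comb (\<lambda>_. 1)" "comb w"] by simp
  have kq: "k * (\<Sum>i<n. w i) = of_nat n" using sum_solution_nonzero by (simp add: k_def)
  show ?thesis
    unfolding F_def comb_diff frob_diff_left frob_diff_right k 1 2 sum_solution kq
    by (simp add: k_def power2_eq_square)
qed

lemma frob_ones_ge: "frob r (comb (\<lambda>_. 1)) (comb (\<lambda>_. 1)) \<ge> (of_nat n)\<^sup>2 / (\<Sum>i<n. w i)"
  using frob_self_nonneg[of r "comb (\<lambda>i. 1 - of_nat n / (\<Sum>i<n. w i) * w i)"]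
  unfolding frob_residual diff_ge_0_iff_ge .

text \<open>The inner product with \<open>outer i\<close> is the \<open>i\<close>-th row sum of
  \<open>A\<close>. Equality forces the residual to vanish, so every row sum is \<open>n\<close>
  over the sum of the \<open>w i\<close>. Conversely, pairing constant row sums \<open>k\<close>
  with \<open>w\<close> gives \<open>k\<close> this value, and the squared norm is
  \<open>n * k\<close>.\<close>

lemma frob_ones_eq_iff:
  "frob r (comb (\<lambda>_. 1)) (comb (\<lambda>_. 1)) = (of_nat n)\<^sup>2 / (\<Sum>i<n. w i) \<longleftrightarrow>
    (\<exists>k. \<forall>i<n. frob r (outer i) (comb (\<lambda>_. 1)) = k)"
proof
  let ?k = "of_nat n / (\<Sum>i<n. w i)"
  let ?F = "comb (\<lambda>i. 1 - ?k * w i)"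
  assume "frob r (comb (\<lambda>_. 1)) (comb (\<lambda>_. 1)) = (of_nat n)\<^sup>2 / (\<Sum>i<n. w i)"
  then have "\<forall>a<r. \<forall>b<r. ?F a b = 0"
    using frob_residual frob_self_eq_0_iff[of r ?F] by simp
  then have "frob r (outer i) ?F = 0" for i by (simp add: frob_def)
  then have "\<forall>i<n. frob r (outer i) (comb (\<lambda>_. 1)) = ?k"
    unfolding comb_diff frob_diff_right by (simp add: w)
  then show "\<exists>k. \<forall>i<n. frob r (outer i) (comb (\<lambda>_. 1)) = k" ..
next
  assume "\<exists>k. \<forall>i<n. frob r (outer i) (comb (\<lambda>_. 1)) = k"
  then obtain k where k: "\<forall>i<n. frob r (outer i) (comb (\<lambda>_. 1)) = k" ..
  have "of_nat n = frob r (comb w) (comb (\<lambda>_. 1))"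
    using frob_comb_solution[of "\<lambda>_. 1"] cnj_frob[of r "comb (\<lambda>_. 1)" "comb w"] by simp
  also have "\<dots> = frob r (comb w) (comb w) * k"
    using k unfolding frob_comb_left by (simp add: w sum_distrib_right)
  finally have "k = of_nat n / (\<Sum>i<n. w i)"
    using sum_solution_nonzero by (simp add: sum_solution field_simps)
  moreover have "frob r (comb (\<lambda>_. 1)) (comb (\<lambda>_. 1)) = of_nat n * k"
    using k by (simp add: frob_comb_left)
  ultimately show "frob r (comb (\<lambda>_. 1)) (comb (\<lambda>_. 1)) = (of_nat n)\<^sup>2 / (\<Sum>i<n. w i)"
    by (simp add: power2_eq_square)
qed

end

end

end

section \<open>Both bounds for the solution \<open>w\<close> given by the Moore-Penrose
  inverse\<close>

theorem theorem2p5: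
  fixes n r :: nat and v :: "nat \<Rightarrow> complex vec"
  assumes n_pos: "n \<ge> 1"
    and dim: "\<And>i. i < n \<Longrightarrow> v i \<in> carrier_vec r"
    and unit: "\<And>i. i < n \<Longrightarrow> herm_inner (v i) (v i) = 1"
  defines "M \<equiv> gram_mat n v"
  defines "A \<equiv> hadamard M (map_mat cnj M)"
  defines "q \<equiv> ones_vec n \<bullet> (pinv A *\<^sub>v ones_vec n)"
  defines "S \<equiv> complex_of_real (\<Sum>i<n. \<Sum>j<n. (cmod (herm_inner (v i) (v j)))\<^sup>2)"
  shows "q \<le> of_nat r
       \<and> (q = of_nat r \<longleftrightarrow> 1\<^sub>m r \<in> mat_span r {outer_sq (v i) | i. i < n})
       \<and> S \<ge> (of_nat n)\<^sup>2 / q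
       \<and> (invertible_mat A \<longrightarrow>
            (S = (of_nat n)\<^sup>2 / q \<longleftrightarrow> (\<exists>k. eigenvector A (ones_vec n) k)))"
proof -
  interpret U: unit_family n r v by (rule unit_family.intro) (fact dim, fact unit)
  have A: "A = U.A" by (simp add: A_def M_def U.A_def)
  have one: "ones_vec n \<in> carrier_vec n" by (simp add: ones_vec_def)
  define w where "w = pinv A *\<^sub>v ones_vec n"
  have wc: "w \<in> carrier_vec n"
    unfolding w_def A using pinv_carrier[OF U.A_carrier U.adjoint_A] one by simp
  \<comment> \<open>This is \<open>A w = 1\<close>, read through
    \<open>frob_outer_comb\<close>.\<close>
  have w: "frob r (U.outer i) (U.comb (($) w)) = 1" if "i < n" for i
    using that U.frob_outer_comb[OF that wc] U.A_mult_pinv_ones by (simp add: w_def A ones_vec_def)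
  have q: "q = (\<Sum>i<n. w $ i)"
    unfolding q_def w_def[symmetric] using wc by (simp add: scalar_prod_def ones_vec_def atLeast0LessThan)
  have S: "S = frob r (U.comb (\<lambda>_. 1)) (U.comb (\<lambda>_. 1))"
  proof -
    have "S = (\<Sum>i<n. \<Sum>j<n. U.A $$ (i, j))"
      unfolding S_def of_real_sum by (intro sum.cong refl) (simp only: U.index_A_cmod lessThan_iff)
    also have "\<dots> = (\<Sum>i<n. \<Sum>j<n. frob r (U.outer i) (U.outer j))"
      by (intro sum.cong refl) (simp only: U.index_A lessThan_iff)
    also have "\<dots> = (\<Sum>j<n. \<Sum>i<n. frob r (U.outer i) (U.outer j))" by (rule sum.swap)
    finally show ?thesis by (simp only: U.frob_comb_left U.frob_comb_right complex_cnj_one mult_1)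
  qed
  have ones: "U.comb (($) (ones_vec n)) = U.comb (\<lambda>_. 1)"
    by (intro ext) (simp add: U.comb_def ones_vec_def)
  \<comment> \<open>The eigenvector equation says that all row sums of \<open>A\<close> equal
    \<open>k\<close>. The all ones vector is nonzero because \<open>n \<ge> 1\<close>.\<close>
  have "eigenvector A (ones_vec n) k \<longleftrightarrow> (\<forall>i<n. frob r (U.outer i) (U.comb (\<lambda>_. 1)) = k)" for k
  proof -
    have "ones_vec n $ 0 \<noteq> 0\<^sub>v n $ 0" using n_pos by (simp add: ones_vec_def)
    then have "ones_vec n \<noteq> 0\<^sub>v n" by metis
    then have "eigenvector A (ones_vec n) k \<longleftrightarrow> A *\<^sub>v ones_vec n = k \<cdot>\<^sub>v ones_vec n"
      using one carrier_matD[OF U.A_carrier] by (simp add: eigenvector_def A)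
    also have "\<dots> \<longleftrightarrow> (\<forall>i<n. (A *\<^sub>v ones_vec n) $ i = k)"
      using carrier_matD[OF U.A_carrier]
      by (auto simp: vec_eq_iff A ones_vec_def simp del: index_mult_mat_vec)
    also have "\<dots> \<longleftrightarrow> (\<forall>i<n. frob r (U.outer i) (U.comb (\<lambda>_. 1)) = k)"
      using U.frob_outer_comb[OF _ one] unfolding A ones by auto
    finally show ?thesis .
  qed
  then show ?thesis
    unfolding q S U.one_in_mat_span_iff
    using U.sum_solution_le[OF w] U.sum_solution_eq_iff[OF w]
      U.frob_ones_ge[OF w n_pos] U.frob_ones_eq_iff[OF w n_pos] by simp
qed

end
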